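(* The degree of the graph $\mathcal{G}$ constructed from a Hamiltonian $\mathcal{H}$ with constant locality $k$ and bounded interaction degree $d$ is bounded, i.e. $\deg(\mathcal{G})\in O(1)$. Explicitly: for all fixed integers $k\ge 1$ and $d\ge 0$ there is a constant $C=C(k,d)$ such that for every $n\ge 1$ and every $n$-qubit Hamiltonian $\mathcal{H}$ that is $k$-local with interaction degree at most $d$, the bipartite graph $\mathcal{G}$ constructed from $\mathcal{H}$ satisfies $$\deg(\mathcal{G})\le C.$$
   Context: A Pauli string on $n$ qubits is a tensor product $p=\bigotimes_{i=1}^n[p]_i$ with $[p]_i\in\{I,X,Y,Z\}$ (the identity and the three Pauli matrices). Every $n$-qubit Hamiltonian is written as $\mathcal{H}=\sum_{r=1}^m c_rp_r$ with pairwise distinct Pauli strings $p_r\in\{I,X,Y,Z\}^{\otimes n}$ and coefficients $c_r\in\mathbb{C}\setminus\{0\}$ (this expansion is unique up to ordering). Locality and interaction degree: $\mathcal{H}$ is $k$-local if it can be expressed as a sum of terms $\mathcal{H}=\sum_i H_i$ in which each $H_i$ acts non-trivially on at most $k$ sites (qubits). The support of $H_i$ is the set of sites on which it acts non-trivially. The interaction graph of $\mathcal{H}$ (with respect to these terms) has vertex set $\{1,\dots,n\}$ and an edge between distinct sites $u,v$ whenever $u$ and $v$ jointly appear in the support of some term $H_i$. The Hamiltonian has interaction degree at most $d$ if every vertex of the interaction graph has degree at most $d$, i.e. each site interacts with at most $d$ other sites. (The locality and the interaction degree refer to the same decomposition $\sum_iH_i$.) Graph of $\mathcal{H}$: the bipartite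 graph $\mathcal{G}$ with vertex set $V=V_Q\cup V_T$ (disjoint), with qubit nodes $V_Q=\{q_1,\dots,q_n\}$ and term nodes $V_T=\{t_1,\dots,t_m\}$, where $t_r$ corresponds to $(c_r,p_r)$, and with an edge $(q_i,t_r)$ if and only if $[p_r]_i\ne I$ (and no other edges). (In the paper $\mathcal{G}$ also carries vertex and edge colours, which play no role for its degree.) The degree $\deg(\mathcal{G})$ is the maximum degree of a vertex of $\mathcal{G}$. *)

theory Defs
  imports "Jordan_Normal_Form.Matrix"
begin

text \<open>Operators on $n$ qubits are complex $2^n \times 2^n$ matrices; the sites are numbered
  $0, \dots, n-1$, site $0$ being the leftmost tensor factor.\<close>

definition kron :: "complex mat \<Rightarrow> complex mat \<Rightarrow> complex mat" (infixr "\<otimes>\<^sub>K" 75) where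
  "A \<otimes>\<^sub>K B = mat (dim_row A * dim_row B) (dim_col A * dim_col B)
     (\<lambda>(i, j). A $$ (i div dim_row B, j div dim_col B) * B $$ (i mod dim_row B, j mod dim_col B))"

definition op_sum :: "nat \<Rightarrow> complex mat list \<Rightarrow> complex mat" where
  "op_sum n Ms = foldr (+) Ms (0\<^sub>m (2 ^ n) (2 ^ n))"


subsection \<open>Pauli strings\<close>

datatype pauli = PI | PX | PY | PZ

fun pauli_mat :: "pauli \<Rightarrow> complex mat" where
  "pauli_mat PI = mat_of_rows_list 2 [[1, 0], [0, 1]]"
| "pauli_mat PX = mat_of_rows_list 2 [[0, 1], [1, 0]]"
| "pauli_mat PY = mat_of_rows_list 2 [[0, - \<i>], [\<i>, 0]]"
| "pauli_mat PZ = mat_of_rows_list 2 [[1, 0], [0, - 1]]"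

text \<open>The list entry \<open>p ! i\<close> is the tensor factor $[p]_i$ at site $i$.\<close>

definition pauli_string_mat :: "pauli list \<Rightarrow> complex mat" where
  "pauli_string_mat p = foldr (\<lambda>s M. pauli_mat s \<otimes>\<^sub>K M) p (1\<^sub>m 1)"

definition pauli_expansion :: "nat \<Rightarrow> complex mat \<Rightarrow> (complex \<times> pauli list) list \<Rightarrow> bool" where
  "pauli_expansion n H ts \<longleftrightarrow>
     (\<forall>(c, p) \<in> set ts. c \<noteq> 0 \<and> length p = n) \<and>
     distinct (map snd ts) \<and>
     H = op_sum n (map (\<lambda>(c, p). c \<cdot>\<^sub>m pauli_string_mat p) ts)"


subsection \<open>Support of an operator\<close>

text \<open>An operator acts trivially on site $i$ iff it is the identity on that tensor factor, that is,
  iff it lies in $\mathrm{End}((\mathbb{C}^2)^{\otimes i}) \otimes 1 \otimes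
  \mathrm{End}((\mathbb{C}^2)^{\otimes (n-1-i)})$, whose elements are the finite sums below.\<close>

definition acts_trivially_on :: "nat \<Rightarrow> nat \<Rightarrow> complex mat \<Rightarrow> bool" where
  "acts_trivially_on n i M \<longleftrightarrow>
     (\<exists>ABs. (\<forall>(A, B) \<in> set ABs. A \<in> carrier_mat (2 ^ i) (2 ^ i) \<and>
                                B \<in> carrier_mat (2 ^ (n - 1 - i)) (2 ^ (n - 1 - i))) \<and>
            M = op_sum n (map (\<lambda>(A, B). A \<otimes>\<^sub>K 1\<^sub>m 2 \<otimes>\<^sub>K B) ABs))"

definition support :: "nat \<Rightarrow> complex mat \<Rightarrow> nat set" where
  "support n M = {i. i < n \<and> \<not> acts_trivially_on n i M}"


subsection \<open>Simple graphs\<close>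

text \<open>A graph is a pair of a vertex set and a set of edges, an edge being the set of its two ends.\<close>

type_synonym 'v graph = "'v set \<times> 'v set set"

definition degree :: "'v graph \<Rightarrow> 'v \<Rightarrow> nat" where
  "degree G v = card {e \<in> snd G. v \<in> e}"

definition max_degree :: "'v graph \<Rightarrow> nat" where
  "max_degree G = Max (degree G ` fst G)"


subsection \<open>Locality and interaction degree\<close>

definition interaction_graph :: "nat \<Rightarrow> complex mat list \<Rightarrow> nat graph" where
  "interaction_graph n Hs =
     ({..<n}, {{u, v} | u v. u \<noteq> v \<and> (\<exists>M \<in> set Hs. u \<in> support n M \<and> v \<in> support n M)})"

text \<open>Locality and interaction degree refer to one and the same decomposition \<open>Hs\<close>; its terms are
  arbitrary operators, not necessarily multiples of Pauli strings.\<close>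

definition local_with_interaction_degree :: "nat \<Rightarrow> nat \<Rightarrow> nat \<Rightarrow> complex mat \<Rightarrow> bool" where
  "local_with_interaction_degree n k d H \<longleftrightarrow>
     (\<exists>Hs. set Hs \<subseteq> carrier_mat (2 ^ n) (2 ^ n) \<and>
           H = op_sum n Hs \<and>
           (\<forall>M \<in> set Hs. card (support n M) \<le> k) \<and>
           (\<forall>v \<in> fst (interaction_graph n Hs). degree (interaction_graph n Hs) v \<le> d))"


subsection \<open>The bipartite graph of a Hamiltonian\<close>

datatype node = Qubit nat | Term nat

definition hamiltonian_graph :: "nat \<Rightarrow> (complex \<times> pauli list) list \<Rightarrow> node graph" where
  "hamiltonian_graph n ts =
     (Qubit ` {..<n} \<union> Term ` {..<length ts},
      {{Qubit i, Term r} | i r. i < n \<and> r < length ts \<and> snd (ts ! r) ! i \<noteq> PI})"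

end

theory Submission
  imports Defs "HOL-Library.FuncSet"
begin

text \<open>Pauli strings are orthogonal for the Hilbert--Schmidt inner product, so a string \<open>p\<close> that
  occurs in the expansion of \<open>H = \<Sum>\<^sub>i H\<^sub>i\<close> satisfies \<open>\<langle>p, H\<^sub>i\<rangle> \<noteq> 0\<close> for some \<open>i\<close>. Since non-identity
  Pauli matrices are traceless, \<open>\<langle>p, M\<rangle> = 0\<close> as soon as \<open>M\<close> acts trivially on a site where \<open>p\<close> does
  not; hence the support of \<open>p\<close> lies in the support of \<open>H\<^sub>i\<close>. So a term node has degree at most \<open>k\<close>,
  and the strings acting on a qubit \<open>v\<close> are supported on the closed neighbourhood of \<open>v\<close> in the
  interaction graph, which leaves at most \<open>4 ^ (d + 1)\<close> of them.\<close>

subsection \<open>Kronecker products\<close>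

lemma dim_kron [simp]:
  "dim_row (A \<otimes>\<^sub>K B) = dim_row A * dim_row B"
  "dim_col (A \<otimes>\<^sub>K B) = dim_col A * dim_col B"
  by (simp_all add: kron_def)

lemma kron_carrier:
  assumes "A \<in> carrier_mat a a'" "B \<in> carrier_mat b b'"
  shows "A \<otimes>\<^sub>K B \<in> carrier_mat (a * b) (a' * b')"
  using assms by auto

lemma index_kron:
  assumes "i < dim_row A * dim_row B" "j < dim_col A * dim_col B"
  shows "(A \<otimes>\<^sub>K B) $$ (i, j) =
    A $$ (i div dim_row B, j div dim_col B) * B $$ (i mod dim_row B, j mod dim_col B)"
  using assms by (simp add: kron_def)

lemma div_mod_bounds:
  assumes "i < a * (b::nat)"
  shows "i div b < a" "i mod b < b"
proof -
  have "b > 0" using assms by (cases b) auto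
  then show "i div b < a" "i mod b < b"
    using assms by (auto simp: less_mult_imp_div_less)
qed

lemma div_mult_div: "(i::nat) div (b * c) = i div c div b"
  by (metis div_mult2_eq mult.commute)

lemma mod_mult_div:
  "(i::nat) mod (b * c) div c = i div c mod b"
proof (cases "c = 0")
  case False
  have "i mod (c * b) = c * (i div c mod b) + i mod c" by (rule mod_mult2_eq)
  then show ?thesis using False by (simp add: mult.commute)
qed simp

lemma mod_mult_mod: "(i::nat) mod (b * c) mod c = i mod c"
  by (simp add: mod_mod_cancel)

text \<open>An index of a triple product has three mixed-radix digits, and both bracketings read off
  the same ones; \<open>div_mult_div\<close>, \<open>mod_mult_div\<close> and
  \<open>mod_mult_mod\<close> identify them.\<close>

lemma kron_assoc: "(A \<otimes>\<^sub>K B) \<otimes>\<^sub>K C = A \<otimes>\<^sub>K (B \<otimes>\<^sub>K C)"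
proof (rule eq_matI)
  fix i j
  assume "i < dim_row (A \<otimes>\<^sub>K (B \<otimes>\<^sub>K C))" "j < dim_col (A \<otimes>\<^sub>K (B \<otimes>\<^sub>K C))"
  then have i: "i < dim_row A * (dim_row B * dim_row C)" "i < dim_row A * dim_row B * dim_row C"
    and j: "j < dim_col A * (dim_col B * dim_col C)" "j < dim_col A * dim_col B * dim_col C"
    by (simp_all add: mult.assoc)
  show "((A \<otimes>\<^sub>K B) \<otimes>\<^sub>K C) $$ (i, j) = (A \<otimes>\<^sub>K (B \<otimes>\<^sub>K C)) $$ (i, j)"
    using i j div_mod_bounds[OF i(2)] div_mod_bounds[OF i(1)]
      div_mod_bounds[OF j(2)] div_mod_bounds[OF j(1)]
    by (simp add: index_kron div_mult_div mod_mult_div mod_mult_mod mult.assoc)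
qed (simp_all add: mult.assoc)

lemma one_kron: "1\<^sub>m 1 \<otimes>\<^sub>K A = A"
  by (rule eq_matI) (simp_all add: index_kron)


subsection \<open>The Hilbert--Schmidt inner product\<close>

text \<open>For matrices of equal size this is the trace of the adjoint of \<open>A\<close> times
  \<open>B\<close>. The entrywise form factors over Kronecker products by regrouping
  indices.\<close>

definition hs_inner :: "complex mat \<Rightarrow> complex mat \<Rightarrow> complex" where
  "hs_inner A B = (\<Sum>i<dim_row A. \<Sum>j<dim_col A. cnj (A $$ (i, j)) * B $$ (i, j))"

lemma sum_div_mod:
  fixes f :: "nat \<Rightarrow> nat \<Rightarrow> 'a::comm_monoid_add"
  shows "(\<Sum>i<a * b. f (i div b) (i mod b)) = (\<Sum>i<a. \<Sum>j<b. f i j)"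
proof -
  have "(\<Sum>i<a. \<Sum>j<b. f i j) = (\<Sum>(i, j)\<in>{..<a} \<times> {..<b}. f i j)"
    by (simp add: sum.cartesian_product)
  also have "\<dots> = (\<Sum>i<a * b. f (i div b) (i mod b))"
  proof (rule sum.reindex_bij_witness
      [where i = "\<lambda>i. (i div b, i mod b)" and j = "\<lambda>(i, j). i * b + j"])
    fix x assume "x \<in> {..<a} \<times> {..<b}"
    then obtain i j where x: "x = (i, j)" "i < a" "j < b" by auto
    have "i * b + j < Suc i * b" using x by simp
    also have "\<dots> \<le> a * b" using x by (intro mult_right_mono) auto
    finally show "(\<lambda>(i, j). i * b + j) x \<in> {..<a * b}" using x by simp
  qed (auto simp: div_mod_bounds)
  finally show ?thesis by simp
qed

lemma hs_inner_kron:
  assumes "A \<in> carrier_mat a a'" "B \<in> carrier_mat b b'"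
    "C \<in> carrier_mat a a'" "D \<in> carrier_mat b b'"
  shows "hs_inner (A \<otimes>\<^sub>K B) (C \<otimes>\<^sub>K D) = hs_inner A C * hs_inner B D"
proof -
  let ?F = "\<lambda>i i' j j'. (cnj (A $$ (i, j)) * C $$ (i, j)) * (cnj (B $$ (i', j')) * D $$ (i', j'))"
  have "hs_inner (A \<otimes>\<^sub>K B) (C \<otimes>\<^sub>K D)
      = (\<Sum>i<a * b. \<Sum>j<a' * b'. ?F (i div b) (i mod b) (j div b') (j mod b'))"
    using assms by (auto simp: hs_inner_def index_kron intro!: sum.cong)
  \<comment> \<open>This order of the four indices is the one that arises when
    \<open>sum_product\<close> expands the product of the two inner products.\<close>
  also have "\<dots> = (\<Sum>i<a. \<Sum>i'<b. \<Sum>j<a'. \<Sum>j'<b'. ?F i i' j j')"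
    by (simp only: sum_div_mod[of "\<lambda>j j'. ?F _ _ j j'"]
        sum_div_mod[of "\<lambda>i i'. \<Sum>j<a'. \<Sum>j'<b'. ?F i i' j j'"])
  also have "\<dots> = hs_inner A C * hs_inner B D"
    using assms by (simp add: hs_inner_def sum_product)
  finally show ?thesis .
qed

lemma hs_inner_add:
  assumes "A \<in> carrier_mat a a'" "B \<in> carrier_mat a a'" "C \<in> carrier_mat a a'"
  shows "hs_inner A (B + C) = hs_inner A B + hs_inner A C"
  using assms by (simp add: hs_inner_def distrib_left sum.distrib)

lemma hs_inner_smult:
  assumes "A \<in> carrier_mat a a'" "B \<in> carrier_mat a a'"
  shows "hs_inner A (c \<cdot>\<^sub>m B) = c * hs_inner A B"
  using assms by (simp add: hs_inner_def sum_distrib_left mult.left_commute)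

lemma op_sum_carrier:
  assumes "set Ms \<subseteq> carrier_mat (2 ^ n) (2 ^ n)"
  shows "op_sum n Ms \<in> carrier_mat (2 ^ n) (2 ^ n)"
  using assms by (induction Ms) (auto simp: op_sum_def)

lemma hs_inner_op_sum:
  assumes "A \<in> carrier_mat (2 ^ n) (2 ^ n)" "set Ms \<subseteq> carrier_mat (2 ^ n) (2 ^ n)"
  shows "hs_inner A (op_sum n Ms) = (\<Sum>M\<leftarrow>Ms. hs_inner A M)"
  using assms(2)
proof (induction Ms)
  case Nil
  show ?case using assms(1) by (simp add: op_sum_def hs_inner_def)
next
  case (Cons M Ms)
  then have "hs_inner A (M + op_sum n Ms) = hs_inner A M + hs_inner A (op_sum n Ms)"
    by (intro hs_inner_add[OF assms(1)] op_sum_carrier) auto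
  then show ?case using Cons by (simp add: op_sum_def)
qed


subsection \<open>Pauli strings\<close>

lemma pauli_mat_carrier: "pauli_mat s \<in> carrier_mat 2 2"
  by (cases s) (auto simp: mat_of_rows_list_def)

lemma hs_inner_pauli_mat: "hs_inner (pauli_mat s) (pauli_mat t) = (if s = t then 2 else 0)"
  by (cases s; cases t)
    (simp_all add: hs_inner_def mat_of_rows_list_def numeral_2_eq_2)

text \<open>Identifies the factor \<open>1\<^sub>m 2\<close> of \<open>acts_trivially_on\<close> as
  a Pauli matrix, so that the tracelessness of X, Y and Z becomes an instance of
  \<open>hs_inner_pauli_mat\<close>.\<close>

lemma pauli_mat_PI: "pauli_mat PI = 1\<^sub>m 2"
  by (rule eq_matI) (auto simp: mat_of_rows_list_def less_2_cases_iff)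

lemma pauli_string_mat_Nil: "pauli_string_mat [] = 1\<^sub>m 1"
  by (simp add: pauli_string_mat_def)

lemma pauli_string_mat_Cons:
  "pauli_string_mat (s # p) = pauli_mat s \<otimes>\<^sub>K pauli_string_mat p"
  by (simp add: pauli_string_mat_def)

lemma pauli_string_mat_carrier:
  "pauli_string_mat p \<in> carrier_mat (2 ^ length p) (2 ^ length p)"
proof (induction p)
  case (Cons s p)
  then show ?case
    using kron_carrier[OF pauli_mat_carrier[of s] Cons] by (simp add: pauli_string_mat_Cons)
qed (simp add: pauli_string_mat_Nil)

lemma pauli_string_mat_append:
  "pauli_string_mat (p @ q) = pauli_string_mat p \<otimes>\<^sub>K pauli_string_mat q"
  by (induction p)
    (simp_all add: pauli_string_mat_Nil pauli_string_mat_Cons one_kron[simplified] kron_assoc)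

text \<open>By \<open>hs_inner_kron\<close> the inner product is a product over the sites: agreement
  contributes 2 and a single disagreement contributes 0.\<close>

lemma hs_inner_pauli_string_mat:
  assumes "length p = length q"
  shows "hs_inner (pauli_string_mat p) (pauli_string_mat q) = (if p = q then 2 ^ length p else 0)"
  using assms
proof (induction p q rule: list_induct2)
  case Nil
  show ?case by (simp add: pauli_string_mat_Nil hs_inner_def)
next
  case (Cons s p t q)
  have "pauli_string_mat q \<in> carrier_mat (2 ^ length p) (2 ^ length p)"
    using pauli_string_mat_carrier[of q] Cons by simp
  then show ?case
    using Cons hs_inner_kron[OF pauli_mat_carrier[of s] pauli_string_mat_carrier[of p]
        pauli_mat_carrier[of t]]
    by (auto simp: pauli_string_mat_Cons hs_inner_pauli_mat)
qed

lemma hs_inner_pauli_string_mat_trivial_site: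
  assumes "i < length p" "p ! i \<noteq> PI" "acts_trivially_on (length p) i M"
  shows "hs_inner (pauli_string_mat p) M = 0"
proof -
  let ?n = "length p" and ?m = "length p - 1 - i"
  obtain ABs where
    ABs: "\<And>A B. (A, B) \<in> set ABs \<Longrightarrow>
        A \<in> carrier_mat (2 ^ i) (2 ^ i) \<and> B \<in> carrier_mat (2 ^ ?m) (2 ^ ?m)"
    and M: "M = op_sum ?n (map (\<lambda>(A, B). A \<otimes>\<^sub>K 1\<^sub>m 2 \<otimes>\<^sub>K B) ABs)"
    using assms(3) unfolding acts_trivially_on_def by fast
  let ?q = "take i p" and ?r = "drop (Suc i) p"
  have "p = ?q @ p ! i # ?r" using assms(1) by (rule id_take_nth_drop)
  then have p: "pauli_string_mat p =
      pauli_string_mat ?q \<otimes>\<^sub>K (pauli_mat (p ! i) \<otimes>\<^sub>K pauli_string_mat ?r)"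
    by (metis pauli_string_mat_append pauli_string_mat_Cons)
  have q: "pauli_string_mat ?q \<in> carrier_mat (2 ^ i) (2 ^ i)"
    using pauli_string_mat_carrier[of ?q] assms(1) by simp
  have r: "pauli_string_mat ?r \<in> carrier_mat (2 ^ ?m) (2 ^ ?m)"
    using pauli_string_mat_carrier[of ?r] by simp
  \<comment> \<open>The subtraction in \<open>?m\<close> is not truncated because
    \<open>i < length p\<close>.\<close>
  have dim: "2 ^ i * (2 * 2 ^ ?m) = (2 ^ ?n :: nat)"
    using assms(1) by (simp flip: power_Suc power_add)
  have summand: "A \<otimes>\<^sub>K 1\<^sub>m 2 \<otimes>\<^sub>K B \<in> carrier_mat (2 ^ ?n) (2 ^ ?n) \<and>
      hs_inner (pauli_string_mat p) (A \<otimes>\<^sub>K 1\<^sub>m 2 \<otimes>\<^sub>K B) = 0" if "(A, B) \<in> set ABs" for A B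
  proof -
    from ABs[OF that] have A: "A \<in> carrier_mat (2 ^ i) (2 ^ i)"
      and B: "B \<in> carrier_mat (2 ^ ?m) (2 ^ ?m)" by auto
    have I: "pauli_mat PI \<otimes>\<^sub>K B \<in> carrier_mat (2 * 2 ^ ?m) (2 * 2 ^ ?m)"
      by (rule kron_carrier[OF pauli_mat_carrier B])
    \<comment> \<open>The middle factor is kept as \<open>pauli_mat PI\<close> here: the inner
      product then has a factor for site \<open>i\<close>, namely that of \<open>p ! i\<close> with
      \<open>PI\<close>, which is 0.\<close>
    have "hs_inner (pauli_string_mat p) (A \<otimes>\<^sub>K pauli_mat PI \<otimes>\<^sub>K B) = 0"
      unfolding p
      using hs_inner_kron[OF q kron_carrier[OF pauli_mat_carrier[of "p ! i"] r] A I]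
        hs_inner_kron[OF pauli_mat_carrier[of "p ! i"] r pauli_mat_carrier[of PI] B] assms(2)
      by (simp add: hs_inner_pauli_mat del: pauli_mat.simps)
    then show ?thesis
      using kron_carrier[OF A I] unfolding pauli_mat_PI dim by blast
  qed
  have "hs_inner (pauli_string_mat p) M =
      (\<Sum>(A, B)\<leftarrow>ABs. hs_inner (pauli_string_mat p) (A \<otimes>\<^sub>K 1\<^sub>m 2 \<otimes>\<^sub>K B))"
    unfolding M using summand
    by (subst hs_inner_op_sum[OF pauli_string_mat_carrier])
      (auto simp: comp_def case_prod_unfold)
  also have "\<dots> = (\<Sum>_\<leftarrow>ABs. 0)"
    using summand by (intro arg_cong[where f = sum_list] map_cong) auto
  finally show ?thesis by simp
qed

text \<open>Coefficient extraction in an orthogonal family whose members have squared norm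
  \<open>2 ^ n\<close>.\<close>

lemma hs_inner_pauli_expansion:
  assumes "pauli_expansion n H ts" "(c, p) \<in> set ts"
  shows "hs_inner (pauli_string_mat p) H = c * 2 ^ n"
proof -
  have len: "length q = n" if "(b, q) \<in> set ts" for b q
    using assms(1) that by (auto simp: pauli_expansion_def)
  have dist: "distinct (map snd ts)"
    and H: "H = op_sum n (map (\<lambda>(c, p). c \<cdot>\<^sub>m pauli_string_mat p) ts)"
    using assms(1) by (auto simp: pauli_expansion_def)
  have carrier: "pauli_string_mat q \<in> carrier_mat (2 ^ n) (2 ^ n)" if "(b, q) \<in> set ts" for b q
    using pauli_string_mat_carrier[of q] len[OF that] by simp
  have "hs_inner (pauli_string_mat p) H =
      (\<Sum>x\<leftarrow>ts. hs_inner (pauli_string_mat p) (fst x \<cdot>\<^sub>m pauli_string_mat (snd x)))"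
    unfolding H using carrier
    by (subst hs_inner_op_sum[OF carrier[OF assms(2)]])
      (auto simp: comp_def case_prod_unfold)
  also have "\<dots> = (\<Sum>x\<leftarrow>ts. if x = (c, p) then c * 2 ^ n else 0)"
  proof (intro arg_cong[where f = sum_list] map_cong refl)
    fix x assume x: "x \<in> set ts"
    obtain b q where bq: "x = (b, q)" by force
    \<comment> \<open>Distinctness of the strings makes \<open>snd\<close> injective on the terms,
      so only \<open>(c, p)\<close> itself contributes to the sum.\<close>
    have "x = (c, p)" if "q = p"
      using dist inj_onD[of snd "set ts" x "(c, p)"] x assms(2) that bq
      by (simp add: distinct_map)
    then show "hs_inner (pauli_string_mat p) (fst x \<cdot>\<^sub>m pauli_string_mat (snd x)) =
        (if x = (c, p) then c * 2 ^ n else 0)"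
      using x bq len[of b q] len[OF assms(2)]
        hs_inner_smult[OF carrier[OF assms(2)] carrier[of b q], of b]
      by (auto simp: hs_inner_pauli_string_mat)
  qed
  also have "\<dots> = c * 2 ^ n"
    using dist assms(2)
    by (simp add: distinct_map sum_list_distinct_conv_sum_set sum.delta)
  finally show ?thesis .
qed

text \<open>This passes from the arbitrary terms of \<open>Hs\<close> to the Pauli expansion. Pauli
  components of different terms may cancel, but a string that survives in the sum must have a
  nonzero component in at least one term.\<close>

lemma pauli_support_subset_support:
  assumes "pauli_expansion n (op_sum n Hs) ts" "set Hs \<subseteq> carrier_mat (2 ^ n) (2 ^ n)"
    "(c, p) \<in> set ts"
  shows "\<exists>M \<in> set Hs. {i. i < n \<and> p ! i \<noteq> PI} \<subseteq> support n M"
proof -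
  have p: "c \<noteq> 0" "length p = n"
    using assms(1,3) by (auto simp: pauli_expansion_def)
  have "(\<Sum>M\<leftarrow>Hs. hs_inner (pauli_string_mat p) M) = c * 2 ^ n"
    using hs_inner_pauli_expansion[OF assms(1,3)] hs_inner_op_sum[OF _ assms(2)]
      pauli_string_mat_carrier[of p] p by simp
  then have "(\<Sum>M\<leftarrow>Hs. hs_inner (pauli_string_mat p) M) \<noteq> 0"
    using p by simp
  then obtain M where M: "M \<in> set Hs" "hs_inner (pauli_string_mat p) M \<noteq> 0"
    by (metis (mono_tags, lifting) map_eq_conv sum_list_0)
  then show ?thesis
    using hs_inner_pauli_string_mat_trivial_site[of _ p M] p by (auto simp: support_def)
qed


subsection \<open>Degrees\<close>

lemma finite_interaction_edges: "finite (snd (interaction_graph n Hs))"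
  by (rule finite_subset[of _ "Pow {..<n}"]) (auto simp: interaction_graph_def support_def)

text \<open>Distinct neighbours \<open>u\<close> give distinct edges \<open>{u, v}\<close>.
  Finiteness keeps \<open>card\<close> from collapsing to 0 on the edges at
  \<open>v\<close>.\<close>

lemma card_neighbours_le_degree:
  assumes "finite (snd G)"
  shows "card {u. u \<noteq> v \<and> {u, v} \<in> snd G} \<le> degree G v"
  unfolding degree_def
  by (rule card_inj_on_le[where f = "\<lambda>u. {u, v}"])
    (use assms in \<open>auto simp: inj_on_def doubleton_eq_iff\<close>)

lemma UNIV_pauli: "UNIV = {PI, PX, PY, PZ}"
  using pauli.exhaust by auto

text \<open>Off \<open>S\<close> such a string is constantly \<open>PI\<close>, so it is determined
  by its restriction to \<open>S\<close>, with four choices per site.\<close>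

lemma card_pauli_strings_supported_on:
  assumes "finite S"
  shows "finite {p. length p = n \<and> {i. i < n \<and> p ! i \<noteq> PI} \<subseteq> S}" (is "finite ?P")
    and "card {p. length p = n \<and> {i. i < n \<and> p ! i \<noteq> PI} \<subseteq> S} \<le> 4 ^ card S"
proof -
  let ?f = "\<lambda>p. restrict ((!) p) S" and ?Q = "S \<rightarrow>\<^sub>E (UNIV :: pauli set)"
  have fin: "finite ?Q" using assms by (intro finite_PiE) (auto simp: UNIV_pauli)
  have "card (UNIV :: pauli set) = 4" by (simp add: UNIV_pauli)
  then have card: "card ?Q = 4 ^ card S" using assms by (simp add: card_PiE)
  have inj: "inj_on ?f ?P"
  proof (rule inj_onI)
    fix p q assume p: "p \<in> ?P" and q: "q \<in> ?P" and eq: "?f p = ?f q"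
    show "p = q"
    proof (rule nth_equalityI)
      fix i assume i: "i < length p"
      show "p ! i = q ! i"
      proof (cases "i \<in> S")
        case True
        then show ?thesis using fun_cong[OF eq, of i] by simp
      next
        case False
        then have "p ! i = PI" "q ! i = PI" using p q i by auto
        then show ?thesis by simp
      qed
    qed (use p q in simp)
  qed
  have sub: "?f ` ?P \<subseteq> ?Q" by auto
  show "finite ?P" using inj sub fin by (rule inj_on_finite)
  show "card ?P \<le> 4 ^ card S" using card_inj_on_le[OF inj sub fin] card by simp
qed

lemma degree_term_le:
  assumes "finite S" "{i. i < n \<and> snd (ts ! r) ! i \<noteq> PI} \<subseteq> S"
  shows "degree (hamiltonian_graph n ts) (Term r) \<le> card S"
proof -
  have "{e \<in> snd (hamiltonian_graph n ts). Term r \<in> e} \<subseteq> (\<lambda>i. {Qubit i, Term r}) ` S"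
    using assms(2) by (auto simp: hamiltonian_graph_def)
  then show ?thesis
    unfolding degree_def using surj_card_le[OF assms(1)] by blast
qed

lemma degree_qubit_le:
  "degree (hamiltonian_graph n ts) (Qubit v) \<le> card {r. r < length ts \<and> snd (ts ! r) ! v \<noteq> PI}"
proof -
  have "{e \<in> snd (hamiltonian_graph n ts). Qubit v \<in> e} \<subseteq>
      (\<lambda>r. {Qubit v, Term r}) ` {r. r < length ts \<and> snd (ts ! r) ! v \<noteq> PI}"
    by (auto simp: hamiltonian_graph_def)
  then show ?thesis
    unfolding degree_def by (intro surj_card_le) auto
qed

lemma max_degree_hamiltonian_graph_le:
  assumes "n \<ge> 1" "local_with_interaction_degree n k d H" "pauli_expansion n H ts"
  shows "max_degree (hamiltonian_graph n ts) \<le> max k (4 ^ Suc d)"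
proof -
  obtain Hs where carrier: "set Hs \<subseteq> carrier_mat (2 ^ n) (2 ^ n)" and H: "H = op_sum n Hs"
    and loc: "\<And>M. M \<in> set Hs \<Longrightarrow> card (support n M) \<le> k"
    and deg: "\<And>v. v < n \<Longrightarrow> degree (interaction_graph n Hs) v \<le> d"
    using assms(2) by (auto simp: local_with_interaction_degree_def interaction_graph_def)
  have sub: "\<exists>M \<in> set Hs. {i. i < n \<and> snd (ts ! r) ! i \<noteq> PI} \<subseteq> support n M"
    if "r < length ts" for r
    using pauli_support_subset_support[OF assms(3)[unfolded H] carrier, of "fst (ts ! r)"] that
    by simp
  have term_le: "degree (hamiltonian_graph n ts) (Term r) \<le> k" if r: "r < length ts" for r
  proof -
    obtain M where M: "M \<in> set Hs" "{i. i < n \<and> snd (ts ! r) ! i \<noteq> PI} \<subseteq> support n M"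
      using sub[OF r] by blast
    have "finite (support n M)" by (simp add: support_def)
    from degree_term_le[OF this M(2)] loc[OF M(1)] show ?thesis by simp
  qed
  have qubit_le: "degree (hamiltonian_graph n ts) (Qubit v) \<le> 4 ^ Suc d" if v: "v < n" for v
  proof -
    let ?N = "{u. u \<noteq> v \<and> {u, v} \<in> snd (interaction_graph n Hs)}"
    \<comment> \<open>The closed neighbourhood of \<open>v\<close>: at most \<open>d\<close>
      neighbours and \<open>v\<close> itself, hence the exponent \<open>Suc d\<close>.\<close>
    let ?S = "insert v ?N" and ?R = "{r. r < length ts \<and> snd (ts ! r) ! v \<noteq> PI}"
    have "finite ?N"
      by (rule finite_subset[of _ "{..<n}"])
        (auto simp: interaction_graph_def support_def doubleton_eq_iff)
    moreover have "card ?N \<le> d"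
      using card_neighbours_le_degree[OF finite_interaction_edges] deg[OF v] by (rule le_trans)
    ultimately have S: "finite ?S" "card ?S \<le> Suc d" by auto
    let ?P = "{p. length p = n \<and> {i. i < n \<and> p ! i \<noteq> PI} \<subseteq> ?S}"
    have "snd (ts ! r) \<in> ?P" if r: "r \<in> ?R" for r
    proof -
      obtain M where M: "M \<in> set Hs" "{i. i < n \<and> snd (ts ! r) ! i \<noteq> PI} \<subseteq> support n M"
        using sub r by blast
      \<comment> \<open>Once \<open>v\<close> lies in the support of \<open>M\<close>, every other
        site of that support is adjacent to \<open>v\<close> in the interaction graph.\<close>
      then have "v \<in> support n M" using r v by auto
      then have "support n M \<subseteq> ?S" using M(1) by (auto simp: interaction_graph_def)
      moreover have "length (snd (ts ! r)) = n"
        using assms(3) r nth_mem[of r ts] by (auto simp: pauli_expansion_def case_prod_unfold)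
      ultimately show ?thesis using M(2) by blast
    qed
    \<comment> \<open>Since the strings are pairwise distinct, counting terms at \<open>v\<close>
      reduces to counting strings supported on \<open>?S\<close>.\<close>
    moreover have "inj_on (\<lambda>r. snd (ts ! r)) ?R"
      using assms(3) by (auto simp: pauli_expansion_def inj_on_def distinct_conv_nth)
    ultimately have "card ?R \<le> card ?P"
      using card_pauli_strings_supported_on(1)[OF S(1)] by (intro card_inj_on_le) auto
    also have "\<dots> \<le> 4 ^ card ?S" by (rule card_pauli_strings_supported_on(2)[OF S(1)])
    also have "\<dots> \<le> 4 ^ Suc d" using S(2) by (intro power_increasing) auto
    finally show ?thesis using degree_qubit_le le_trans by blast
  qed
  show ?thesis
    unfolding max_degree_def
  proof (rule Max.boundedI)
    \<comment> \<open>\<open>n \<ge> 1\<close> provides a qubit node, so \<open>Max\<close> is taken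
      over a nonempty set.\<close>
    show "degree (hamiltonian_graph n ts) ` fst (hamiltonian_graph n ts) \<noteq> {}"
      using assms(1) by (auto simp: hamiltonian_graph_def lessThan_empty_iff)
    fix x assume "x \<in> degree (hamiltonian_graph n ts) ` fst (hamiltonian_graph n ts)"
    then consider v where "v < n" "x = degree (hamiltonian_graph n ts) (Qubit v)"
      | r where "r < length ts" "x = degree (hamiltonian_graph n ts) (Term r)"
      by (auto simp: hamiltonian_graph_def)
    then show "x \<le> max k (4 ^ Suc d)"
      using term_le qubit_le by cases (simp_all add: le_max_iff_disj)
  qed (simp add: hamiltonian_graph_def)
qed

theorem proposition3:
  fixes k d :: nat
  assumes "k \<ge> 1"
  shows "\<exists>C :: nat. \<forall>n \<ge> 1. \<forall>H \<in> carrier_mat (2 ^ n) (2 ^ n). \<forall>ts.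
           local_with_interaction_degree n k d H \<longrightarrow> pauli_expansion n H ts \<longrightarrow>
           max_degree (hamiltonian_graph n ts) \<le> C"
  \<comment> \<open>The witness is \<open>max k (4 ^ Suc d)\<close>, which depends on neither
    \<open>n\<close> nor \<open>H\<close>.\<close>
  using max_degree_hamiltonian_graph_le by blast

end
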